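(* Let $b$ and $n$ be natural numbers with $1<n<b$, and let $M$ be the $(n,b)$-mother graph. If $(d_1,d_2)$ is an edge of $M$, then there are integers $c_1,c_2$ with $0\leq c_1\leq n-1$ and $0\leq c_2\leq n-1$ such that $bc_2-c_1=nd_2-d_1$.
   Context: For a natural-number base $b>1$, the base-$b$ digits are the integers $0,1,\ldots,b-1$. For an integer $x$, $\lambda(x)$ denotes the least non-negative residue of $x$ modulo $b$. The $(n,b)$-mother graph $M$ is the directed graph whose vertices are the base-$b$ digits and whose edges are the ordered pairs $(d_1,d_2)$ of base-$b$ digits satisfying $\lambda\left(d_1+(b-n)d_2\right)\leq n-1$. *)

theory Defs
  imports "Graph_Theory.Pair_Digraph"
begin

definition digits :: "nat \<Rightarrow> int set" where
  "digits b = {0..int b - 1}"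

(* For b > 0, the HOL remainder x mod int b lies in {0..<int b} for every integer x. *)
definition least_residue :: "nat \<Rightarrow> int \<Rightarrow> int" where
  "least_residue b x = x mod int b"

(* Vertices are integers, so that b - n is the integer difference, not truncated subtraction. *)
definition mother_graph :: "nat \<Rightarrow> nat \<Rightarrow> int pair_pre_digraph" where
  "mother_graph n b =
     \<lparr> pverts = digits b,
       parcs = {(d1, d2). d1 \<in> digits b \<and> d2 \<in> digits b \<and>
                  least_residue b (d1 + (int b - int n) * d2) \<le> int n - 1} \<rparr>"

end

theory Submission
  imports Defs
begin

text \<open>Modulo \<open>b\<close>, the number \<open>d1 + (b - n) * d2\<close> is
  \<open>d1 - n * d2\<close>, so the edge condition says that dividing \<open>d1 - n * d2\<close> by
  \<open>b\<close> leaves a remainder \<open>c1 \<le> n - 1\<close>. With \<open>c2\<close> the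
  negated quotient, the required equation is division with remainder. The ranges of
  \<open>d1\<close>, \<open>d2\<close> and \<open>c1\<close> then confine \<open>c2\<close>.\<close>

theorem theorem3p2:
  fixes b n :: nat and M :: "int pair_pre_digraph" and d1 d2 :: int
  assumes "1 < n" and "n < b"
    and "M = mother_graph n b"
    and "(d1, d2) \<in> parcs M"
  shows "\<exists>c1 c2 :: int. 0 \<le> c1 \<and> c1 \<le> int n - 1 \<and> 0 \<le> c2 \<and> c2 \<le> int n - 1 \<and>
           int b * c2 - c1 = int n * d2 - d1"
proof -
  define c1 where "c1 = (d1 - int n * d2) mod int b"
  define c2 where "c2 = - ((d1 - int n * d2) div int b)"
  have d: "0 \<le> d1" "d1 \<le> int b - 1" "0 \<le> d2" "d2 \<le> int b - 1"
    and le: "(d1 + (int b - int n) * d2) mod int b \<le> int n - 1"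
    using assms(3,4) by (auto simp: mother_graph_def digits_def least_residue_def)
  have "d1 + (int b - int n) * d2 = (d1 - int n * d2) + d2 * int b"
    by (simp add: algebra_simps)
  then have "(d1 + (int b - int n) * d2) mod int b = c1"
    by (simp only: c1_def mod_mult_self1)
  with le assms(2) have c1: "0 \<le> c1" "c1 \<le> int n - 1"
    by (auto simp: c1_def)
  have eq: "int b * c2 - c1 = int n * d2 - d1"
    using mult_div_mod_eq[of "int b" "d1 - int n * d2"] unfolding c1_def c2_def mult_minus_right by linarith
  have "0 \<le> int n * d2" "int n * d2 \<le> int n * (int b - 1)"
    using d by (simp_all add: mult_left_mono)
  moreover have "int n * (int b - 1) = int b * int n - int n"
    by (simp add: algebra_simps)
  \<comment> \<open>By \<open>eq\<close>, \<open>b * c2 = n * d2 - d1 + c1\<close>. This is at least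
    \<open>1 - b\<close> (case \<open>d2 = 0\<close>, \<open>d1 = b - 1\<close>,
    \<open>c1 = 0\<close>) and at most \<open>(b * n - n) + (n - 1) = b * n - 1\<close>. Both bounds
    are strict against multiples of \<open>b\<close>, so cancelling \<open>b\<close> leaves exactly
    the integers from \<open>0\<close> to \<open>n - 1\<close> for \<open>c2\<close>.\<close>
  ultimately have "int b * (-1) < int b * c2" "int b * c2 < int b * int n"
    using eq c1 d by linarith+
  then have "-1 < c2" "c2 < int n"
    using assms(2) by (simp_all only: mult_less_cancel_left_pos of_nat_0_less_iff)
  then show ?thesis
    using c1 eq by (intro exI[of _ c1] exI[of _ c2]) auto
qed

end
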